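(* Let $k\ge 1$ and let $T_1,\dots,T_k$ be trees, where $T_i$ has order $n_i$, diameter $d_i\ge 2$ and unique weight center $w_i$ (i.e. $W(T_i)=\{w_i\}$). Let $T_{w_k}$ be the tree obtained from the disjoint union of $T_1,\dots,T_k$ by identifying the vertices $w_1,\dots,w_k$ into a single vertex $w$, and let $d=\mathrm{diam}(T_{w_k})$. Suppose that each $T_i$ ($1\le i\le k$) admits a good ordering. Then $T_{w_k}$ admits a good ordering, and $$\mathrm{rn}(T_{w_k})=\sum_{i=1}^{k}\bigl[\mathrm{rn}(T_i)+(n_i-1)(d-d_i)\bigr]-k+1.$$
   Context: All graphs are finite, connected and undirected; $d(u,v)$ is the distance between $u$ and $v$, and $\mathrm{diam}(G)$ is the maximum distance between two vertices of $G$. A radio labeling of $G$ is a map $f:V(G)\to\{0,1,2,\dots\}$ with $|f(u)-f(v)|\ge \mathrm{diam}(G)+1-d(u,v)$ for all distinct $u,v$; its span is $\max\{|f(u)-f(v)|:u,v\in V(G)\}$, and the radio number $\mathrm{rn}(G)$ is the minimum span over all radio labelings of $G$. For a tree $T$ and $v\in V(T)$, the weight of $T$ from $v$ is $w_T(v)=\sum_{u\in V(T)}d(u,v)$; a weight center is a vertex minimizing $w_T(v)$, and $W(T)$ denotes the set of weight centers (it has one vertex, or two adjacent vertices). The level of $u\in V(T)$ is $L(u)=\min\{d(u,x):x\in W(T)\}$, and the total level is $L(T)=\sum_{u\in V(T)}L(u)$. Put $\varepsilon(T)=1$ if $|W(T)|=1$ and $\varepsilon(T)=0$ if $|W(T)|=2$.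 A tree $T$ of order $p$ and diameter $d\ge2$, with $\varepsilon=\varepsilon(T)$, is said to admit a good ordering if there is a linear order $u_0,u_1,\dots,u_{p-1}$ of $V(T)$ such that (a) $u_0=w$ and $u_{p-1}$ is adjacent to $w$ when $W(T)=\{w\}$, and $\{u_0,u_{p-1}\}=\{w,w'\}$ when $W(T)=\{w,w'\}$; and (b) for all $0\le i<j\le p-1$, $d(u_i,u_j)\ge \sum_{t=i}^{j-1}(L(u_t)+L(u_{t+1}))-(j-i)(d+\varepsilon)+(d+1)$. (It is known, from earlier work of Bantva et al., that $T$ admits a good ordering if and only if $\mathrm{rn}(T)=(p-1)(d+\varepsilon)-2L(T)+\varepsilon$.) *)

theory Defs
  imports "Graph_Theory.Graph_Theory"
begin

text \<open>
  An undirected graph is a \<open>pair_graph\<close>: finite, without loops, with every edge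
  present as the two arcs \<open>(u,v)\<close> and \<open>(v,u)\<close>.  The library predicate \<open>tree\<close> cannot be used
  for such graphs: it forbids all directed cycles, including the closed walk \<open>u, v, u\<close> along a
  single edge.  A cycle of the undirected graph is a \<open>cycle\<close> with at least three arcs.
\<close>

definition undirected_tree :: "'a pair_pre_digraph \<Rightarrow> bool" where
  "undirected_tree G \<longleftrightarrow>
     pair_graph G \<and> Digraph_Component.connected (with_proj G) \<and>
     \<not> (\<exists>p. pre_digraph.cycle (with_proj G) p \<and> 3 \<le> length p)"

definition gdist :: "'a pair_pre_digraph \<Rightarrow> 'a \<Rightarrow> 'a \<Rightarrow> nat" where
  "gdist G u v = (LEAST n. \<exists>p. pre_digraph.awalk (with_proj G) u p v \<and> length p = n)"

definition gdiam :: "'a pair_pre_digraph \<Rightarrow> nat" where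
  "gdiam G = Max {gdist G u v |u v. u \<in> pverts G \<and> v \<in> pverts G}"

definition radio_labeling :: "'a pair_pre_digraph \<Rightarrow> ('a \<Rightarrow> nat) \<Rightarrow> bool" where
  "radio_labeling G f \<longleftrightarrow>
     (\<forall>u\<in>pverts G. \<forall>v\<in>pverts G. u \<noteq> v \<longrightarrow>
        \<bar>int (f u) - int (f v)\<bar> \<ge> int (gdiam G) + 1 - int (gdist G u v))"

definition label_span :: "'a pair_pre_digraph \<Rightarrow> ('a \<Rightarrow> nat) \<Rightarrow> nat" where
  "label_span G f = Max {nat \<bar>int (f u) - int (f v)\<bar> |u v. u \<in> pverts G \<and> v \<in> pverts G}"

definition radio_number :: "'a pair_pre_digraph \<Rightarrow> nat" where
  "radio_number G = (LEAST s. \<exists>f. radio_labeling G f \<and> label_span G f = s)"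

definition weight_from :: "'a pair_pre_digraph \<Rightarrow> 'a \<Rightarrow> nat" where
  "weight_from T v = (\<Sum>u\<in>pverts T. gdist T u v)"

definition weight_centers :: "'a pair_pre_digraph \<Rightarrow> 'a set" where
  "weight_centers T = {v \<in> pverts T. \<forall>x\<in>pverts T. weight_from T v \<le> weight_from T x}"

definition level :: "'a pair_pre_digraph \<Rightarrow> 'a \<Rightarrow> nat" where
  "level T u = Min {gdist T u x |x. x \<in> weight_centers T}"

text \<open>A tree has one or two weight centers, so the second case below means two.\<close>

definition epsilon :: "'a pair_pre_digraph \<Rightarrow> nat" where
  "epsilon T = (if card (weight_centers T) = 1 then 1 else 0)"

definition good_ordering :: "'a pair_pre_digraph \<Rightarrow> (nat \<Rightarrow> 'a) \<Rightarrow> bool" where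
  "good_ordering T u \<longleftrightarrow>
     (let p = card (pverts T); d = gdiam T in
        bij_betw u {..<p} (pverts T) \<and>
        ((\<exists>w. weight_centers T = {w} \<and> u 0 = w \<and> (u (p - 1), w) \<in> parcs T) \<or>
         (\<exists>w w'. w \<noteq> w' \<and> weight_centers T = {w, w'} \<and> {u 0, u (p - 1)} = {w, w'})) \<and>
        (\<forall>i j. i < j \<and> j \<le> p - 1 \<longrightarrow>
           int (gdist T (u i) (u j)) \<ge>
             (\<Sum>t = i..j - 1. int (level T (u t) + level T (u (t + 1))))
             - int (j - i) * int (d + epsilon T) + int (d + 1)))"

definition admits_good_ordering :: "'a pair_pre_digraph \<Rightarrow> bool" where
  "admits_good_ordering T \<longleftrightarrow> (\<exists>u. good_ordering T u)"

definition disjoint_union :: "'i set \<Rightarrow> ('i \<Rightarrow> 'a pair_pre_digraph) \<Rightarrow> ('i \<times> 'a) pair_pre_digraph" where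
  "disjoint_union I T =
     \<lparr> pverts = (SIGMA i:I. pverts (T i)),
       parcs = {((i, x), (i, y)) |i x y. i \<in> I \<and> (x, y) \<in> parcs (T i)} \<rparr>"

text \<open>
  Identifying the vertices of a set \<open>S\<close> yields the quotient graph whose vertices are the
  classes of the equivalence relation merging \<open>S\<close>: the set \<open>S\<close> itself is the new vertex, and
  every other vertex \<open>v\<close> becomes \<open>{v}\<close>.
\<close>

definition ident_class :: "'a set \<Rightarrow> 'a \<Rightarrow> 'a set" where
  "ident_class S v = (if v \<in> S then S else {v})"

definition identify :: "'a set \<Rightarrow> 'a pair_pre_digraph \<Rightarrow> 'a set pair_pre_digraph" where
  "identify S G =
     \<lparr> pverts = ident_class S ` pverts G,
       parcs = {(ident_class S x, ident_class S y) |x y. (x, y) \<in> parcs G} \<rparr>"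

definition one_point_union ::
  "'i set \<Rightarrow> ('i \<Rightarrow> 'a pair_pre_digraph) \<Rightarrow> ('i \<Rightarrow> 'a) \<Rightarrow> ('i \<times> 'a) set pair_pre_digraph" where
  "one_point_union I T w = identify {(i, w i) |i. i \<in> I} (disjoint_union I T)"

end

theory Submission
  imports Defs
begin

text \<open>
  With a unique weight center \<open>w\<close>, put \<open>L x = d(x, w)\<close>. Condition (b) of a good ordering then says that
  between positions \<open>i < j\<close> the excess \<open>\<Sum> (2 L(u\<^sub>t) - (d + 1))\<close>, over \<open>i < t < j\<close>, is at most
  \<open>d(u\<^sub>i, u\<^sub>j) - L(u\<^sub>i) - L(u\<^sub>j)\<close>. Comparing with the first vertex \<open>w\<close> and with the last vertex, a neighbour
  of \<open>w\<close>, shows that the non-central vertices have excess at most 0 on every prefix and every suffix.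
  Vertices of different branches of the one-point union satisfy \<open>d(x, y) = L x + L y\<close>, and the diameter
  only grows, so \<open>w\<close> followed by the non-central vertices of \<open>T\<^sub>1, \<dots>, T\<^sub>k\<close> in turn is a good ordering.

  A good ordering forces \<open>rn = (p - 1)(d + 1) - 2 L(T) + 1\<close>: sorting the vertices of any radio labeling
  by label and using \<open>d(x, y) \<le> L x + L y\<close> gives the lower bound, and the labeling that
  makes this estimate an equality between consecutive vertices is a radio labeling by (b). Since \<open>p - 1\<close>
  and \<open>L\<close> are additive over the branches, the formula for the one-point union follows.
\<close>

section \<open>Distances in connected graphs\<close>

text \<open>Relational powers of \<open>parcs G\<close> compose and reverse easily, so distances are
  handled through them instead of arc lists. The start vertex is assumed because
  \<open>awalk\<close> demands it even for the empty walk.\<close>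

lemma awalk_length_iff_relpow:
  assumes "u \<in> pverts G"
  shows "(\<exists>p. pre_digraph.awalk (with_proj G) u p v \<and> length p = n) \<longleftrightarrow> (u, v) \<in> parcs G ^^ n"
proof -
  have "(\<exists>p. set p \<subseteq> parcs G \<and> pcas u p v \<and> length p = n) \<longleftrightarrow> (u, v) \<in> parcs G ^^ n"
  proof (induction n arbitrary: u)
    case 0
    then show ?case by auto
  next
    case (Suc n)
    have "(\<exists>p. set p \<subseteq> parcs G \<and> pcas u p v \<and> length p = Suc n) \<longleftrightarrow>
          (\<exists>x. (u, x) \<in> parcs G \<and> (\<exists>p. set p \<subseteq> parcs G \<and> pcas x p v \<and> length p = n))"
      (is "?L \<longleftrightarrow> ?R")
    proof
      assume ?L
      then obtain e es where "set (e # es) \<subseteq> parcs G" "pcas u (e # es) v" "length es = n"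
        by (metis length_Suc_conv)
      then show ?R by (cases e) auto
    next
      assume ?R
      then obtain x p where "(u, x) \<in> parcs G" "set p \<subseteq> parcs G" "pcas x p v" "length p = n"
        by blast
      then show ?L by (intro exI[of _ "(u, x) # p"]) auto
    qed
    also have "\<dots> \<longleftrightarrow> (u, v) \<in> parcs G ^^ Suc n"
      unfolding Suc.IH by (meson relpow_Suc_D2 relpow_Suc_I2)
    finally show ?case .
  qed
  then show ?thesis
    using assms by (simp add: pre_digraph.awalk_def cas_with_proj_eq conj_assoc)
qed

lemma gdist_eq_Least_relpow:
  "u \<in> pverts G \<Longrightarrow> gdist G u v = (LEAST n. (u, v) \<in> parcs G ^^ n)"
  by (simp add: gdist_def awalk_length_iff_relpow)

lemma gdist_le: "u \<in> pverts G \<Longrightarrow> (u, v) \<in> parcs G ^^ n \<Longrightarrow> gdist G u v \<le> n"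
  by (simp add: gdist_eq_Least_relpow Least_le)

lemma relpow_sym: "sym R \<Longrightarrow> (u, v) \<in> R ^^ n \<Longrightarrow> (v, u) \<in> R ^^ n"
proof (induction n arbitrary: v)
  case (Suc n)
  then obtain y where "(u, y) \<in> R ^^ n" "(y, v) \<in> R" by auto
  then show ?case using Suc by (metis relpow_Suc_I2 symD)
qed simp

text \<open>Reachability of every pair is what makes the \<open>LEAST\<close> in
  \<open>gdist\<close> attained, so that \<open>gdist\<close> is a metric on the vertices.\<close>

locale connected_pair_graph = pair_graph +
  assumes reach: "u \<in> pverts G \<Longrightarrow> v \<in> pverts G \<Longrightarrow> (u, v) \<in> (parcs G)\<^sup>*"
begin

lemma gdist_relpow:
  assumes "u \<in> pverts G" "v \<in> pverts G"
  shows "(u, v) \<in> parcs G ^^ gdist G u v"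
  using reach[OF assms] assms
  by (metis LeastI_ex gdist_eq_Least_relpow rtrancl_imp_relpow)

lemma gdist_refl: "u \<in> pverts G \<Longrightarrow> gdist G u u = 0"
  using gdist_le[of u G u 0] by simp

lemma gdist_eq_0_iff:
  assumes "u \<in> pverts G" "v \<in> pverts G"
  shows "gdist G u v = 0 \<longleftrightarrow> u = v"
  using gdist_relpow[OF assms] gdist_refl assms by force

lemma sym_parcs: "sym (parcs G)"
  using pair_sym_arcs by (simp add: symmetric_def)

lemma gdist_commute_le:
  assumes "u \<in> pverts G" "v \<in> pverts G"
  shows "gdist G v u \<le> gdist G u v"
  by (meson assms gdist_le gdist_relpow relpow_sym sym_parcs)

lemma gdist_commute:
  "u \<in> pverts G \<Longrightarrow> v \<in> pverts G \<Longrightarrow> gdist G u v = gdist G v u"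
  by (simp add: gdist_commute_le antisym)

lemma gdist_triangle:
  assumes "u \<in> pverts G" "v \<in> pverts G" "x \<in> pverts G"
  shows "gdist G u x \<le> gdist G u v + gdist G v x"
proof -
  have "(u, x) \<in> parcs G ^^ (gdist G u v + gdist G v x)"
    unfolding relpow_add using gdist_relpow assms by blast
  then show ?thesis by (rule gdist_le[OF assms(1)])
qed

lemma gdist_arc: "(u, v) \<in> parcs G \<Longrightarrow> gdist G u v = 1"
proof -
  assume a: "(u, v) \<in> parcs G"
  then have uv: "u \<in> pverts G" "v \<in> pverts G" "u \<noteq> v"
    using wellformed' pair_no_loops by force+
  have "gdist G u v \<le> 1" using a uv gdist_le[of u G v 1] by simp
  with uv show ?thesis using gdist_eq_0_iff[of u v] by linarith
qed

lemma finite_gdists: "finite {gdist G u v |u v. u \<in> pverts G \<and> v \<in> pverts G}"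
proof -
  have "{gdist G u v |u v. u \<in> pverts G \<and> v \<in> pverts G} =
        (\<lambda>(u, v). gdist G u v) ` (pverts G \<times> pverts G)" by auto
  then show ?thesis using pair_finite_verts by simp
qed

lemma gdist_le_gdiam: "u \<in> pverts G \<Longrightarrow> v \<in> pverts G \<Longrightarrow> gdist G u v \<le> gdiam G"
  unfolding gdiam_def using finite_gdists by (intro Max_ge) auto

end

lemma undirected_tree_connected:
  assumes "undirected_tree G"
  shows "connected_pair_graph G"
proof -
  interpret pair_graph G using assms by (simp add: undirected_tree_def)
  show ?thesis
  proof
    fix u v assume uv: "u \<in> pverts G" "v \<in> pverts G"
    \<comment> \<open>Connectedness is strong connectedness of the symmetric closure, and this graph
      is already symmetric.\<close>
    have "u \<rightarrow>\<^sup>*\<^bsub>with_proj (mk_symmetric (with_proj G))\<^esub> v"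
      using assms uv by (auto simp: undirected_tree_def connected_def strongly_connected_def)
    then have "u \<rightarrow>\<^sup>*\<^bsub>with_proj G\<^esub> v"
      using reachable_mk_symmetric_eq pair_sym_arcs by blast
    then show "(u, v) \<in> (parcs G)\<^sup>*"
      unfolding reachable_def by (metis rtrancl_on_rtranclI with_proj_simps(3))
  qed
qed

section \<open>Good orderings and the radio number\<close>

text \<open>Each inner \<open>l t\<close> occurs in two consecutive pairs and each end value in one;
  subtracting \<open>c\<close> per step and adding one back leaves one \<open>c\<close> for each of
  the \<open>j - i - 1\<close> inner positions. This turns condition (b) into a bound on the
  excess.\<close>

lemma sum_consecutive_pairs:
  fixes l :: "nat \<Rightarrow> int"
  assumes "i < j"
  shows "(\<Sum>t = i..j - 1. l t + l (t + 1)) - int (j - i) * c + c =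
         (\<Sum>t\<in>{i<..<j}. 2 * l t - c) + l i + l j"
proof -
  have "Suc i \<le> j" using assms by simp
  then show ?thesis
  proof (induction j rule: dec_induct)
    case base
    have "{i<..<Suc i} = {}" by auto
    then show ?case by simp
  next
    case (step j)
    have *: "{i<..<Suc j} = insert j {i<..<j}" using step.hyps by auto
    have **: "{i..Suc j - 1} = insert j {i..j - 1}" using step.hyps by auto
    have "Suc j - i = Suc (j - i)" using step.hyps by simp
    then show ?case using step.IH step.hyps unfolding * ** by (simp add: algebra_simps)
  qed
qed

lemma level_unique_center: "weight_centers G = {w} \<Longrightarrow> level G u = gdist G u w"
  by (simp add: level_def)

lemma epsilon_unique_center: "weight_centers G = {w} \<Longrightarrow> epsilon G = 1"
  by (simp add: epsilon_def)

text \<open>With a single center, \<open>level\<close> is the distance to \<open>w\<close> and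
  \<open>epsilon\<close> is 1, so the two constants \<open>d + epsilon\<close> and
  \<open>d + 1\<close> of condition (b) coincide and serve as the \<open>c\<close> of
  \<open>sum_consecutive_pairs\<close>. The alternative with two centers in (a) cannot
  occur.\<close>

lemma good_ordering_unique_center_iff:
  assumes "weight_centers G = {w}"
  shows "good_ordering G u \<longleftrightarrow>
    bij_betw u {..<card (pverts G)} (pverts G) \<and> u 0 = w \<and> (u (card (pverts G) - 1), w) \<in> parcs G \<and>
    (\<forall>i j. i < j \<and> j < card (pverts G) \<longrightarrow>
       (\<Sum>t\<in>{i<..<j}. 2 * int (gdist G (u t) w) - (int (gdiam G) + 1)) \<le>
       int (gdist G (u i) (u j)) - int (gdist G (u i) w) - int (gdist G (u j) w))"
proof -
  have centers: "weight_centers G = {a} \<longleftrightarrow> a = w" for a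
    using assms by auto
  have no_pair: "\<not> (a \<noteq> b \<and> weight_centers G = {a, b})" for a b
    using assms by (metis doubleton_eq_iff insert_absorb2)
  have bound: "j \<le> card (pverts G) - 1 \<longleftrightarrow> j < card (pverts G)" if "i < j" for i j :: nat
    using that by linarith
  have gap: "int D \<ge> (\<Sum>t = i..j - 1. int (level G (u t) + level G (u (t + 1))))
               - int (j - i) * int (gdiam G + epsilon G) + int (gdiam G + 1) \<longleftrightarrow>
             (\<Sum>t\<in>{i<..<j}. 2 * int (gdist G (u t) w) - (int (gdiam G) + 1)) \<le>
               int D - int (gdist G (u i) w) - int (gdist G (u j) w)" if "i < j" for i j D
    using sum_consecutive_pairs[OF that, of "\<lambda>t. int (gdist G (u t) w)" "int (gdiam G) + 1"]
    by (simp add: level_unique_center[OF assms] epsilon_unique_center[OF assms]) (auto simp: algebra_simps)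
  show ?thesis
    unfolding good_ordering_def Let_def using centers no_pair bound gap by (smt (verit))
qed

text \<open>Vertices are inserted by increasing \<open>f\<close>: each lies above the current
  maximum \<open>b\<close> by at least \<open>c - l x - l b\<close>, and these gaps telescope. Every
  vertex borders two gaps except the two ends, which explains \<open>l a + l b\<close>; the clause
  on \<open>a = b\<close> keeps the ends distinct once there are two vertices.\<close>

lemma separated_labeling_span_ge:
  fixes f :: "'a \<Rightarrow> int" and l :: "'a \<Rightarrow> int"
  assumes "finite V" "V \<noteq> {}"
    and "\<And>x y. x \<in> V \<Longrightarrow> y \<in> V \<Longrightarrow> x \<noteq> y \<Longrightarrow> c - l x - l y \<le> \<bar>f x - f y\<bar>"
  shows "\<exists>a\<in>V. \<exists>b\<in>V. (\<forall>x\<in>V. f x \<le> f b) \<and> (a = b \<longrightarrow> card V = 1) \<and>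
           (int (card V) - 1) * c - 2 * sum l V + l a + l b \<le> f b - f a"
  using assms
proof (induction V rule: finite_ranking_induct[where f = f])
  case empty
  then show ?case by simp
next
  case (insert x S)
  \<comment> \<open>The ranking induction does not make \<open>x\<close> fresh, hence the first
    case.\<close>
  consider "x \<in> S" | "S = {}" | "x \<notin> S" "S \<noteq> {}" by blast
  then show ?case
  proof cases
    case 1
    then have "insert x S = S" by blast
    with insert.IH insert.prems show ?thesis by metis
  next
    case 2
    then show ?thesis by simp
  next
    case 3
    from 3(2) insert.IH insert.prems obtain a b where ab: "a \<in> S" "b \<in> S" "\<forall>x\<in>S. f x \<le> f b"
        "(int (card S) - 1) * c - 2 * sum l S + l a + l b \<le> f b - f a"
      by blast
    have "c - l x - l b \<le> \<bar>f x - f b\<bar>" using ab 3 insert.prems by blast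
    moreover have "f b \<le> f x" using ab insert.hyps by blast
    ultimately have "(int (card (insert x S)) - 1) * c - 2 * sum l (insert x S) + l a + l x \<le> f x - f a"
      using ab(4) 3(1) insert.hyps(1) by (simp add: algebra_simps)
    moreover have "a \<noteq> x" using ab 3 by blast
    moreover have "\<forall>y\<in>insert x S. f y \<le> f x" using insert.hyps by auto
    ultimately show ?thesis using ab(1) by blast
  qed
qed

section \<open>The minimum span in terms of the total level\<close>

context connected_pair_graph
begin

lemma finite_label_diffs: "finite {nat \<bar>int (f u) - int (f v)\<bar> |u v. u \<in> pverts G \<and> v \<in> pverts G}"
proof -
  have "{nat \<bar>int (f u) - int (f v)\<bar> |u v. u \<in> pverts G \<and> v \<in> pverts G} =
        (\<lambda>(u, v). nat \<bar>int (f u) - int (f v)\<bar>) ` (pverts G \<times> pverts G)" by auto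
  then show ?thesis using pair_finite_verts by simp
qed

lemma label_span_ge:
  assumes "u \<in> pverts G" "v \<in> pverts G"
  shows "int (f u) - int (f v) \<le> int (label_span G f)"
proof -
  have "nat \<bar>int (f u) - int (f v)\<bar> \<le> label_span G f"
    unfolding label_span_def using finite_label_diffs assms by (intro Max_ge) auto
  then show ?thesis by linarith
qed

lemma label_span_le:
  assumes "pverts G \<noteq> {}"
    and "\<And>u v. u \<in> pverts G \<Longrightarrow> v \<in> pverts G \<Longrightarrow> \<bar>int (f u) - int (f v)\<bar> \<le> int s"
  shows "label_span G f \<le> s"
proof -
  have "{nat \<bar>int (f u) - int (f v)\<bar> |u v. u \<in> pverts G \<and> v \<in> pverts G} \<noteq> {}"
    using assms(1) by blast
  then show ?thesis
    unfolding label_span_def using finite_label_diffs[of f] assms(2)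
    by (subst Max_le_iff) fastforce+
qed

text \<open>A detour through \<open>w\<close> bounds each distance by the sum of two levels, so
  every radio labeling has the gaps required by \<open>separated_labeling_span_ge\<close>.\<close>

lemma label_span_lower_bound:
  assumes w: "w \<in> pverts G" and card: "2 \<le> card (pverts G)" and f: "radio_labeling G f"
  shows "(int (card (pverts G)) - 1) * (int (gdiam G) + 1)
           - 2 * (\<Sum>v\<in>pverts G. int (gdist G v w)) + 1 \<le> int (label_span G f)"
proof -
  have sep: "int (gdiam G) + 1 - int (gdist G x w) - int (gdist G y w) \<le> \<bar>int (f x) - int (f y)\<bar>"
    if "x \<in> pverts G" "y \<in> pverts G" "x \<noteq> y" for x y
  proof -
    have "gdist G x y \<le> gdist G x w + gdist G y w"
      using gdist_triangle[of x w y] gdist_commute[of w y] that w by simp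
    moreover have "\<bar>int (f x) - int (f y)\<bar> \<ge> int (gdiam G) + 1 - int (gdist G x y)"
      using f that unfolding radio_labeling_def by blast
    ultimately show ?thesis by linarith
  qed
  have "pverts G \<noteq> {}" using w by blast
  from separated_labeling_span_ge[OF pair_finite_verts this sep]
  obtain a b where ab: "a \<in> pverts G" "b \<in> pverts G" "a \<noteq> b"
    "(int (card (pverts G)) - 1) * (int (gdiam G) + 1) - 2 * (\<Sum>v\<in>pverts G. int (gdist G v w))
       + int (gdist G a w) + int (gdist G b w) \<le> int (f b) - int (f a)"
    using card by force
  \<comment> \<open>At most one of the distinct ends is \<open>w\<close>; this is the origin of the
    final \<open>+ 1\<close>.\<close>
  have "gdist G a w + gdist G b w \<ge> 1"
    using gdist_eq_0_iff[OF ab(1) w] gdist_eq_0_iff[OF ab(2) w] ab(3)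
    by (cases "gdist G a w = 0") auto
  moreover have "int (f b) - int (f a) \<le> int (label_span G f)"
    using label_span_ge ab by blast
  ultimately show ?thesis using ab(4) by linarith
qed

text \<open>Consecutive vertices of the ordering get labels that differ by exactly
  \<open>c - l s - l (s + 1)\<close>. Condition (b) in excess form is then precisely the radio
  condition for all pairs, and the last label bounds the span.\<close>

lemma good_ordering_labeling:
  assumes wc: "weight_centers G = {w}" and u: "good_ordering G u"
  shows "\<exists>f. radio_labeling G f \<and> int (label_span G f) \<le>
     (int (card (pverts G)) - 1) * (int (gdiam G) + 1) - 2 * (\<Sum>v\<in>pverts G. int (gdist G v w)) + 1"
proof -
  define p where "p = card (pverts G)"
  define c where "c = int (gdiam G) + 1"
  define l where "l t = int (gdist G (u t) w)" for t
  have bij: "bij_betw u {..<p} (pverts G)" and u0: "u 0 = w" and last: "(u (p - 1), w) \<in> parcs G"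
    and gap: "\<And>i j. i < j \<Longrightarrow> j < p \<Longrightarrow>
        (\<Sum>t\<in>{i<..<j}. 2 * l t - c) \<le> int (gdist G (u i) (u j)) - l i - l j"
    using u unfolding good_ordering_unique_center_iff[OF wc] p_def c_def l_def by auto
  have w: "w \<in> pverts G" using wc by (auto simp: weight_centers_def)
  then have "p > 0" unfolding p_def using pair_finite_verts card_gt_0_iff by blast
  have "p \<noteq> 1" using u0 last pair_no_loops by force
  with \<open>p > 0\<close> have p: "p \<ge> 2" by linarith
  have uV: "u t \<in> pverts G" if "t < p" for t using bij that by (auto simp: bij_betw_def)
  define F where "F t = (\<Sum>s<t. c - l s - l (s + 1))" for t
  have step: "c - int (gdist G (u i) (u j)) \<le> F j - F i" if "i < j" "j < p" for i j
  proof -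
    have "F j - F i = (\<Sum>t = i..<j. c - l t - l (t + 1))"
      unfolding F_def using that(1) sum_diff_nat_ivl[of 0 i j "\<lambda>s. c - l s - l (s + 1)"]
      by (simp add: atLeast0LessThan)
    also have "{i..<j} = {i..j - 1}" using that(1) by auto
    also have "(\<Sum>t = i..j - 1. c - l t - l (t + 1)) = int (j - i) * c - (\<Sum>t = i..j - 1. l t + l (t + 1))"
      using that(1) by (simp add: sum_subtractf sum.distrib algebra_simps)
    finally have "F j - F i = c - ((\<Sum>t\<in>{i<..<j}. 2 * l t - c) + l i + l j)"
      using sum_consecutive_pairs[OF that(1), of l c] by linarith
    then show ?thesis using gap[OF that] by linarith
  qed
  \<comment> \<open>Distances are at most \<open>gdiam G\<close>, so \<open>c - gdist\<close> is at
    least 1. Hence the labels increase from 0 along the ordering and survive the conversion by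
    \<open>nat\<close>.\<close>
  have mono: "F i \<le> F j" if "i \<le> j" "j < p" for i j
  proof (cases "i = j")
    case False
    then have "i < j" using that by simp
    moreover have "gdist G (u i) (u j) \<le> gdiam G" using gdist_le_gdiam uV that by simp
    ultimately show ?thesis using step[of i j] that(2) unfolding c_def by linarith
  qed simp
  have F0: "F 0 = 0" by (simp add: F_def)
  have Fnn: "F t \<ge> 0" if "t < p" for t using mono[of 0 t] that F0 by simp
  \<comment> \<open>\<open>g x\<close> is the position of \<open>x\<close> in the ordering.\<close>
  define g where "g = the_inv_into {..<p} u"
  define f where "f = (\<lambda>x. nat (F (g x)))"
  have g: "g x < p" "u (g x) = x" if "x \<in> pverts G" for x
    using bij that f_the_inv_into_f_bij_betw[OF bij] the_inv_into_into[of u "{..<p}" x "{..<p}"]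
    unfolding g_def bij_betw_def by auto
  have fF: "int (f x) = F (g x)" if "x \<in> pverts G" for x
    unfolding f_def using Fnn g that by simp
  have sep: "int (gdiam G) + 1 - int (gdist G x y) \<le> \<bar>int (f x) - int (f y)\<bar>"
    if xy: "x \<in> pverts G" "y \<in> pverts G" "x \<noteq> y" for x y
  proof -
    have "g x \<noteq> g y" using g xy by metis
    then consider "g x < g y" | "g y < g x" by linarith
    then show ?thesis
    proof cases
      case 1
      then show ?thesis using step[OF 1] g xy fF unfolding c_def by fastforce
    next
      case 2
      then show ?thesis using step[OF 2] g xy fF gdist_commute[of x y] unfolding c_def by fastforce
    qed
  qed
  \<comment> \<open>The two ends enter only one gap each; by (a) their levels are 0 and 1, which
    yields the same \<open>+ 1\<close> as in the lower bound.\<close>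
  have "l 0 = 0" using gdist_refl w u0 by (simp add: l_def)
  have "l (p - 1) = 1" using gdist_arc last by (simp add: l_def)
  have sumV: "(\<Sum>v\<in>pverts G. int (gdist G v w)) = (\<Sum>t<p. l t)"
    unfolding l_def using sum.reindex_bij_betw[OF bij, of "\<lambda>v. int (gdist G v w)"] by simp
  have sum_F: "F m = int m * c - 2 * (\<Sum>t<Suc m. l t) + l 0 + l m" for m
    unfolding F_def by (induction m) (auto simp: algebra_simps)
  have "F (p - 1) = (int p - 1) * c - 2 * (\<Sum>t<p. l t) + 1"
    using sum_F[of "p - 1"] p \<open>l 0 = 0\<close> \<open>l (p - 1) = 1\<close> by (simp add: of_nat_diff)
  moreover have "label_span G f \<le> nat (F (p - 1))"
  proof (rule label_span_le)
    show "pverts G \<noteq> {}" using w by blast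
    fix x y assume xy: "x \<in> pverts G" "y \<in> pverts G"
    have "0 \<le> int (f z) \<and> int (f z) \<le> F (p - 1)" if "z \<in> pverts G" for z
      using mono[of "g z" "p - 1"] g(1)[OF that] fF[OF that] by simp
    from this[OF xy(1)] this[OF xy(2)] show "\<bar>int (f x) - int (f y)\<bar> \<le> int (nat (F (p - 1)))"
      by linarith
  qed
  moreover have "F (p - 1) \<ge> 0" using Fnn p by simp
  ultimately have "int (label_span G f) \<le> (int p - 1) * c - 2 * (\<Sum>v\<in>pverts G. int (gdist G v w)) + 1"
    using sumV by linarith
  moreover have "radio_labeling G f" unfolding radio_labeling_def using sep by blast
  ultimately show ?thesis unfolding p_def c_def by blast
qed

text \<open>A single vertex would have to be \<open>w\<close> and its own neighbour.\<close>

lemma good_ordering_card_ge_2: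
  assumes wc: "weight_centers G = {w}" and u: "good_ordering G u"
  shows "2 \<le> card (pverts G)"
proof -
  have "u 0 = w" "(u (card (pverts G) - 1), w) \<in> parcs G"
    using u unfolding good_ordering_unique_center_iff[OF wc] by auto
  then have "card (pverts G) - 1 \<noteq> 0" using pair_no_loops by (metis fst_conv snd_conv)
  then show ?thesis by linarith
qed

lemma radio_number_good_ordering:
  assumes wc: "weight_centers G = {w}" and u: "good_ordering G u"
  shows "int (radio_number G) =
     (int (card (pverts G)) - 1) * (int (gdiam G) + 1) - 2 * (\<Sum>v\<in>pverts G. int (gdist G v w)) + 1"
    (is "_ = ?b")
proof -
  have w: "w \<in> pverts G" using wc by (auto simp: weight_centers_def)
  have low: "?b \<le> int (label_span G f)" if "radio_labeling G f" for f
    using label_span_lower_bound[OF w good_ordering_card_ge_2[OF wc u] that] .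
  obtain f where f: "radio_labeling G f" "int (label_span G f) \<le> ?b"
    using good_ordering_labeling[OF wc u] by blast
  then have eq: "int (label_span G f) = ?b" using low by (simp add: antisym)
  have "radio_number G = label_span G f"
    unfolding radio_number_def
  proof (rule Least_equality)
    show "\<exists>f'. radio_labeling G f' \<and> label_span G f' = label_span G f" using f by blast
  next
    fix s assume "\<exists>f'. radio_labeling G f' \<and> label_span G f' = s"
    then show "label_span G f \<le> s" using low eq by (metis of_nat_le_iff)
  qed
  with eq show ?thesis by simp
qed

end

section \<open>Concatenating orderings\<close>

text \<open>An invariant for orderings without the center: the first clause is condition (b) in
  excess form, and the other two bound the excess of prefixes and suffixes, as pairs of entries from
  different branches require. The constant \<open>c\<close> is free, so that a branch can be
  measured against the diameter of the union.\<close>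

definition balanced :: "('b \<Rightarrow> 'b \<Rightarrow> int) \<Rightarrow> ('b \<Rightarrow> int) \<Rightarrow> int \<Rightarrow> 'b list \<Rightarrow> bool" where
  "balanced D l c xs \<longleftrightarrow>
     (\<forall>i j. i < j \<and> j < length xs \<longrightarrow>
        (\<Sum>t = Suc i..<j. 2 * l (xs ! t) - c) \<le> D (xs ! i) (xs ! j) - l (xs ! i) - l (xs ! j)) \<and>
     (\<forall>j\<le>length xs. (\<Sum>t = 0..<j. 2 * l (xs ! t) - c) \<le> 0) \<and>
     (\<forall>i\<le>length xs. (\<Sum>t = i..<length xs. 2 * l (xs ! t) - c) \<le> 0)"

text \<open>Between two entries on opposite sides of the seam lie a suffix of \<open>xs\<close> and
  a prefix of \<open>ys\<close>, both of excess at most 0, while \<open>cross\<close> makes the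
  right-hand side 0. Prefixes and suffixes of the whole list split in the same way.\<close>

lemma balanced_append:
  assumes xs: "balanced D l c xs" and ys: "balanced D l c ys"
    and cross: "\<And>x y. x \<in> set xs \<Longrightarrow> y \<in> set ys \<Longrightarrow> D x y = l x + l y"
  shows "balanced D l c (xs @ ys)"
proof -
  define g where "g z = 2 * l z - c" for z
  let ?m = "length xs" and ?zs = "xs @ ys"
  have left: "(\<Sum>t = a..<b. g (?zs ! t)) = (\<Sum>t = a..<b. g (xs ! t))" if "b \<le> ?m" for a b
    using that by (intro sum.cong) (auto simp: nth_append)
  have right: "(\<Sum>t = a + ?m..<b + ?m. g (?zs ! t)) = (\<Sum>t = a..<b. g (ys ! t))" for a b
    unfolding sum.shift_bounds_nat_ivl by (simp add: nth_append)
  have both: "(\<Sum>t = a..<b + ?m. g (?zs ! t)) = (\<Sum>t = a..<?m. g (xs ! t)) + (\<Sum>t = 0..<b. g (ys ! t))"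
    if "a \<le> ?m" for a b
    using sum.atLeastLessThan_concat[OF that, of "b + ?m" "\<lambda>t. g (?zs ! t)"] left[of ?m a] right[of 0 b]
    by simp
  have tight: "(\<Sum>t = Suc i..<j. g (?zs ! t)) \<le> D (?zs ! i) (?zs ! j) - l (?zs ! i) - l (?zs ! j)"
    if ij: "i < j" "j < length ?zs" for i j
  proof -
    consider "j < ?m" | "?m \<le> i" | "i < ?m" "?m \<le> j" by linarith
    then show ?thesis
    proof cases
      case 1
      then show ?thesis using xs ij left[of j] unfolding balanced_def g_def by (simp add: nth_append)
    next
      case 2
      then obtain i' where i: "i = i' + ?m" by (metis le_add_diff_inverse2)
      obtain j' where j: "j = j' + ?m" using 2 ij by (metis le_add_diff_inverse2 le_trans less_imp_le)
      show ?thesis using ys ij right[of "Suc i'" j'] unfolding balanced_def g_def i j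
        by (simp add: nth_append)
    next
      case 3
      then obtain j' where j: "j = j' + ?m" by (metis le_add_diff_inverse2)
      have "(\<Sum>t = Suc i..<?m. g (xs ! t)) \<le> 0" using xs 3 unfolding balanced_def g_def by simp
      moreover have "(\<Sum>t = 0..<j'. g (ys ! t)) \<le> 0"
        using ys ij j unfolding balanced_def g_def by simp
      moreover have "D (?zs ! i) (?zs ! j) = l (?zs ! i) + l (?zs ! j)"
        using cross[of "xs ! i" "ys ! j'"] 3 ij j by (simp add: nth_append)
      ultimately show ?thesis using both[of "Suc i" j'] 3 j by simp
    qed
  qed
  have pre: "(\<Sum>t = 0..<j. g (?zs ! t)) \<le> 0" if "j \<le> length ?zs" for j
  proof (cases "j \<le> ?m")
    case True
    then show ?thesis using xs left[of j 0] unfolding balanced_def g_def by simp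
  next
    case False
    then obtain j' where j: "j = j' + ?m" by (metis le_add_diff_inverse2 linear)
    then show ?thesis using xs ys that both[of 0 j'] unfolding balanced_def g_def
      by (smt (verit) add_le_cancel_right length_append add.commute le_refl zero_le)
  qed
  have suf: "(\<Sum>t = i..<length ?zs. g (?zs ! t)) \<le> 0" if "i \<le> length ?zs" for i
  proof (cases "i \<le> ?m")
    case True
    then show ?thesis using xs ys both[of i "length ys"] unfolding balanced_def g_def
      by (smt (verit) length_append add.commute le_refl zero_le)
  next
    case False
    then obtain i' where i: "i = i' + ?m" by (metis le_add_diff_inverse2 linear)
    then show ?thesis using ys that right[of i' "length ys"] unfolding balanced_def g_def
      by (simp add: add.commute)
  qed
  show ?thesis unfolding balanced_def using tight pre suf unfolding g_def by blast
qed

lemma balanced_concat: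
  assumes "distinct js" and "\<And>j. j \<in> set js \<Longrightarrow> balanced D l c (B j)"
    and "\<And>i j x y. i \<in> set js \<Longrightarrow> j \<in> set js \<Longrightarrow> i \<noteq> j \<Longrightarrow> x \<in> set (B i) \<Longrightarrow> y \<in> set (B j) \<Longrightarrow>
           D x y = l x + l y"
  shows "balanced D l c (concat (map B js))"
  using assms
proof (induction js)
  case Nil
  then show ?case by (simp add: balanced_def)
next
  case (Cons j js)
  have "balanced D l c (concat (map B js))"
  proof (rule Cons.IH)
    fix i k x y
    assume "i \<in> set js" "k \<in> set js" "i \<noteq> k" "x \<in> set (B i)" "y \<in> set (B k)"
    then show "D x y = l x + l y" by (intro Cons.prems(3)) auto
  qed (use Cons.prems in auto)
  moreover have "D x y = l x + l y" if "x \<in> set (B j)" "y \<in> set (concat (map B js))" for x y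
    using that Cons.prems(1) Cons.prems(3)[of j] by fastforce
  ultimately have "balanced D l c (B j @ concat (map B js))"
    using Cons.prems(2) by (intro balanced_append) auto
  then show ?case by simp
qed

text \<open>Replacing \<open>gdiam G + 1\<close> by a larger \<open>c\<close> only lowers the
  excess. The range starts at 1 in order to drop the center \<open>u 0\<close>.\<close>

lemma (in connected_pair_graph) balanced_good_ordering:
  assumes wc: "weight_centers G = {w}" and u: "good_ordering G u"
    and diam: "1 \<le> gdiam G" and c: "int (gdiam G) + 1 \<le> c"
  shows "balanced (\<lambda>x y. int (gdist G x y)) (\<lambda>x. int (gdist G x w)) c (map u [1..<card (pverts G)])"
proof -
  define p where "p = card (pverts G)"
  define l where "l x = int (gdist G x w)" for x
  define g where "g t = 2 * l (u t) - c" for t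
  have bij: "bij_betw u {..<p} (pverts G)" and u0: "u 0 = w" and last: "(u (p - 1), w) \<in> parcs G"
    and gap0: "\<And>i j. i < j \<Longrightarrow> j < p \<Longrightarrow>
        (\<Sum>t\<in>{i<..<j}. 2 * l (u t) - (int (gdiam G) + 1)) \<le> int (gdist G (u i) (u j)) - l (u i) - l (u j)"
    using u unfolding good_ordering_unique_center_iff[OF wc] p_def l_def by auto
  have gap: "(\<Sum>t = Suc i..<j. g t) \<le> int (gdist G (u i) (u j)) - l (u i) - l (u j)"
    if "i < j" "j < p" for i j
  proof -
    have "(\<Sum>t = Suc i..<j. g t) \<le> (\<Sum>t\<in>{i<..<j}. 2 * l (u t) - (int (gdiam G) + 1))"
      unfolding atLeastSucLessThan_greaterThanLessThan g_def using c by (intro sum_mono) simp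
    then show ?thesis using gap0[OF that] by linarith
  qed
  have w: "w \<in> pverts G" using wc by (auto simp: weight_centers_def)
  have uV: "u t \<in> pverts G" if "t < p" for t using bij that by (auto simp: bij_betw_def)
  have p: "2 \<le> p" using good_ordering_card_ge_2[OF wc u] p_def by simp
  have l0: "l (u 0) = 0" using gdist_refl w u0 by (simp add: l_def)
  have llast: "l (u (p - 1)) = 1" using gdist_arc last by (simp add: l_def)
  \<comment> \<open>Comparison with the last vertex: the triangle inequality through
    \<open>w\<close> makes the bound in \<open>gap\<close> at most 0, and the last term itself is
    \<open>2 - c\<close>, where \<open>c\<close> is at least 2.\<close>
  have suf: "(\<Sum>t = Suc i..<p. g t) \<le> 0" if "i < p" for i
  proof (cases "i = p - 1")
    case False
    then have i: "i < p - 1" using that by simp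
    have "gdist G (u i) (u (p - 1)) \<le> gdist G (u i) w + gdist G w (u (p - 1))"
      using gdist_triangle uV w p that by simp
    then have "int (gdist G (u i) (u (p - 1))) \<le> l (u i) + l (u (p - 1))"
      using gdist_commute[of w "u (p - 1)"] w uV[of "p - 1"] p unfolding l_def by simp
    then have "(\<Sum>t = Suc i..<p - 1. g t) \<le> 0" using gap[of i "p - 1"] i by simp
    moreover have "(\<Sum>t = Suc i..<p. g t) = (\<Sum>t = Suc i..<p - 1. g t) + g (p - 1)"
      using sum.atLeastLessThan_Suc[of "Suc i" "p - 1" g] i p by simp
    moreover have "g (p - 1) \<le> 0" using llast c diam by (simp add: g_def)
    ultimately show ?thesis by linarith
  qed (use p in simp)
  \<comment> \<open>Comparison with \<open>u 0 = w\<close>, for which the bound in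
    \<open>gap\<close> is 0. The case \<open>j = p\<close> is out of reach of \<open>gap\<close>,
    but there the prefix is the whole list and hence a suffix.\<close>
  have pre: "(\<Sum>t = Suc 0..<j. g t) \<le> 0" if "j \<le> p" for j
  proof -
    have "j = 0 \<or> 0 < j \<and> j < p \<or> j = p" using that by linarith
    then consider "j = 0" | "0 < j" "j < p" | "j = p" by blast
    then show ?thesis
    proof cases
      case 2
      then have "int (gdist G (u 0) (u j)) = l (u j)"
        using gdist_commute[of w "u j"] w uV[of j] u0 by (simp add: l_def)
      then show ?thesis using gap[OF 2] l0 by simp
    qed (use suf[of 0] p in auto)
  qed
  \<comment> \<open>Position \<open>t\<close> of the list holds \<open>u (t + 1)\<close>.\<close>
  have shift: "(\<Sum>t = a..<b. 2 * l (map u [1..<p] ! t) - c) = (\<Sum>t = Suc a..<Suc b. g t)"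
    if "b \<le> p - 1" for a b
    unfolding sum.shift_bounds_Suc_ivl g_def using that by (intro sum.cong) auto
  show ?thesis
    unfolding balanced_def p_def[symmetric] l_def[symmetric]
  proof (intro conjI allI impI)
    fix i j assume ij: "i < j \<and> j < length (map u [1..<p])"
    then show "(\<Sum>t = Suc i..<j. 2 * l (map u [1..<p] ! t) - c)
      \<le> int (gdist G (map u [1..<p] ! i) (map u [1..<p] ! j)) - l (map u [1..<p] ! i) - l (map u [1..<p] ! j)"
      using gap[of "Suc i" "Suc j"] by (subst shift) auto
  next
    fix j assume "j \<le> length (map u [1..<p])"
    then show "(\<Sum>t = 0..<j. 2 * l (map u [1..<p] ! t) - c) \<le> 0"
      using pre[of "Suc j"] p by (subst shift) auto
  next
    fix i assume "i \<le> length (map u [1..<p])"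
    then show "(\<Sum>t = i..<length (map u [1..<p]). 2 * l (map u [1..<p] ! t) - c) \<le> 0"
      using suf[of i] p by (subst shift) auto
  qed
qed

lemma balanced_map:
  assumes "balanced D l c xs"
    and "\<And>x y. x \<in> set xs \<Longrightarrow> y \<in> set xs \<Longrightarrow> D' (h x) (h y) = D x y"
    and "\<And>x. x \<in> set xs \<Longrightarrow> l' (h x) = l x"
  shows "balanced D' l' c (map h xs)"
proof -
  have "(\<Sum>t = a..<b. 2 * l' (map h xs ! t) - c) = (\<Sum>t = a..<b. 2 * l (xs ! t) - c)"
    if "b \<le> length xs" for a b
    using that assms(3) by (intro sum.cong) auto
  then show ?thesis
    using assms unfolding balanced_def by simp
qed

section \<open>The one-point union\<close>

locale centered_graph_family =
  fixes I :: "'i set" and T :: "'i \<Rightarrow> 'a pair_pre_digraph" and w :: "'i \<Rightarrow> 'a"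
  assumes finite_I: "finite I" and I_nonempty: "I \<noteq> {}"
    and connected_T: "i \<in> I \<Longrightarrow> connected_pair_graph (T i)"
    and center_T: "i \<in> I \<Longrightarrow> weight_centers (T i) = {w i}"
begin

text \<open>The quotient map restricted to branch \<open>i\<close>: it sends \<open>w i\<close> to
  \<open>hub\<close> and keeps all other vertices apart.\<close>

definition q :: "'i \<Rightarrow> 'a \<Rightarrow> ('i \<times> 'a) set" where
  "q i x = ident_class {(i, w i) |i. i \<in> I} (i, x)"

definition hub :: "('i \<times> 'a) set" where
  "hub = {(i, w i) |i. i \<in> I}"

abbreviation Tw :: "('i \<times> 'a) set pair_pre_digraph" where
  "Tw \<equiv> one_point_union I T w"

lemma q_center: "i \<in> I \<Longrightarrow> q i (w i) = hub"
  by (auto simp: q_def hub_def ident_class_def)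

lemma q_noncenter: "x \<noteq> w i \<Longrightarrow> q i x = {(i, x)}"
  by (auto simp: q_def ident_class_def)

lemma q_eq_iff:
  assumes "i \<in> I" "j \<in> I"
  shows "q i x = q j y \<longleftrightarrow> (i = j \<and> x = y) \<or> (x = w i \<and> y = w j)"
proof -
  \<comment> \<open>With a single branch \<open>hub\<close> is itself a singleton, so it is told
    apart from \<open>{(j, y)}\<close> by having only centers as members.\<close>
  have "hub \<noteq> {(j, y)}" if "y \<noteq> w j" for j y
    using that I_nonempty unfolding hub_def by blast
  then show ?thesis
    using assms by (cases "x = w i"; cases "y = w j") (auto simp: q_center q_noncenter)
qed

lemma pverts_Tw: "pverts Tw = {q i x |i x. i \<in> I \<and> x \<in> pverts (T i)}"
  by (auto simp: one_point_union_def identify_def disjoint_union_def q_def)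

lemma parcs_Tw: "parcs Tw = {(q i x, q i y) |i x y. i \<in> I \<and> (x, y) \<in> parcs (T i)}"
  by (auto simp: one_point_union_def identify_def disjoint_union_def q_def)

lemma center_vertex: "i \<in> I \<Longrightarrow> w i \<in> pverts (T i)"
  using center_T by (auto simp: weight_centers_def)

lemma hub_vertex: "hub \<in> pverts Tw"
  using I_nonempty center_vertex q_center unfolding pverts_Tw by blast

section \<open>Distances in the one-point union\<close>

definition D :: "'i \<Rightarrow> 'a \<Rightarrow> 'i \<Rightarrow> 'a \<Rightarrow> nat" where
  "D i x j y = (if i = j then gdist (T i) x y else gdist (T i) x (w i) + gdist (T j) (w j) y)"

lemma relpow_q:
  assumes "i \<in> I" "(x, y) \<in> parcs (T i) ^^ n"
  shows "(q i x, q i y) \<in> parcs Tw ^^ n"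
  using assms(2)
proof (induction n arbitrary: y)
  case (Suc n)
  then obtain z where "(x, z) \<in> parcs (T i) ^^ n" "(z, y) \<in> parcs (T i)" by auto
  then have "(q i x, q i z) \<in> parcs Tw ^^ n" "(q i z, q i y) \<in> parcs Tw"
    using Suc.IH assms(1) unfolding parcs_Tw by blast+
  then show ?case by auto
qed simp

lemma relpow_D:
  assumes i: "i \<in> I" "x \<in> pverts (T i)" and j: "j \<in> I" "y \<in> pverts (T j)"
  shows "(q i x, q j y) \<in> parcs Tw ^^ D i x j y"
proof -
  interpret i: connected_pair_graph "T i" using connected_T i by blast
  interpret j: connected_pair_graph "T j" using connected_T j by blast
  show ?thesis
  proof (cases "i = j")
    case True
    then show ?thesis using i.gdist_relpow relpow_q i j by (simp add: D_def)
  next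
    case False
    have "(q i x, hub) \<in> parcs Tw ^^ gdist (T i) x (w i)"
      using relpow_q[OF i(1)] i.gdist_relpow i center_vertex q_center by metis
    moreover have "(hub, q j y) \<in> parcs Tw ^^ gdist (T j) (w j) y"
      using relpow_q[OF j(1)] j.gdist_relpow j center_vertex q_center by metis
    ultimately show ?thesis using False by (simp add: D_def relpow_add relcompI)
  qed
qed

text \<open>\<open>D\<close> from a fixed start is 0 at that start and grows by at most 1 along each
  arc, so no walk is shorter than \<open>D\<close>; the walks of \<open>relpow_D\<close> attain
  it.\<close>

lemma D_le_relpow:
  assumes i: "i \<in> I" "x \<in> pverts (T i)" and j: "j \<in> I" "y \<in> pverts (T j)"
    and "(q i x, q j y) \<in> parcs Tw ^^ n"
  shows "D i x j y \<le> n"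
  using j assms(5)
proof (induction n arbitrary: j y)
  case 0
  \<comment> \<open>Even here the representatives may differ, namely as centers of two branches;
    \<open>D\<close> is 0 in that case too.\<close>
  then have "q i x = q j y" by simp
  then show ?case
    using q_eq_iff[OF i(1) 0(1), of x y] i 0 connected_T center_vertex
    by (auto simp: D_def connected_pair_graph.gdist_refl)
next
  case (Suc n)
  then obtain Q where Q: "(q i x, Q) \<in> parcs Tw ^^ n" "(Q, q j y) \<in> parcs Tw" by auto
  then obtain m a b where m: "m \<in> I" "(a, b) \<in> parcs (T m)" "Q = q m a" "q j y = q m b"
    unfolding parcs_Tw by blast
  interpret m: connected_pair_graph "T m" using connected_T m by blast
  interpret i: connected_pair_graph "T i" using connected_T i by blast
  have ab: "a \<in> pverts (T m)" "b \<in> pverts (T m)" using m m.wellformed' by auto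
  have IH: "D i x m a \<le> n" using Suc.IH[OF m(1) ab(1)] Q m by simp
  have "D i x m b \<le> D i x m a + 1"
    using m.gdist_arc[OF m(2)] m.gdist_triangle[OF _ ab, of x] m.gdist_triangle[OF _ ab, of "w m"]
      i ab center_vertex[OF m(1)]
    by (auto simp: D_def)
  \<comment> \<open>\<open>q j y\<close> and \<open>q m b\<close> are one vertex. Its
    representatives differ only when both are centers, and \<open>D\<close> does not depend on that
    choice.\<close>
  moreover have "D i x j y = D i x m b"
    using q_eq_iff[OF Suc.prems(1) m(1), of y b] m(4) connected_T center_vertex m Suc.prems
    by (auto simp: D_def connected_pair_graph.gdist_refl)
  ultimately show ?case using IH by simp
qed

lemma gdist_Tw:
  assumes i: "i \<in> I" "x \<in> pverts (T i)" and j: "j \<in> I" "y \<in> pverts (T j)"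
  shows "gdist Tw (q i x) (q j y) = D i x j y"
proof -
  have "q i x \<in> pverts Tw" using i unfolding pverts_Tw by blast
  then have "gdist Tw (q i x) (q j y) = (LEAST n. (q i x, q j y) \<in> parcs Tw ^^ n)"
    by (rule gdist_eq_Least_relpow)
  also have "\<dots> = D i x j y"
    using relpow_D[OF assms] D_le_relpow[OF assms] by (intro Least_equality)
  finally show ?thesis .
qed

lemma gdist_Tw_same:
  "i \<in> I \<Longrightarrow> x \<in> pverts (T i) \<Longrightarrow> y \<in> pverts (T i) \<Longrightarrow> gdist Tw (q i x) (q i y) = gdist (T i) x y"
  by (simp add: gdist_Tw D_def)

lemma gdist_Tw_hub:
  "i \<in> I \<Longrightarrow> x \<in> pverts (T i) \<Longrightarrow> gdist Tw (q i x) hub = gdist (T i) x (w i)"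
  using gdist_Tw_same[of i x "w i"] by (simp add: q_center center_vertex)

lemma finite_pverts_T: "i \<in> I \<Longrightarrow> finite (pverts (T i))"
  using connected_T connected_pair_graph.axioms(1) pair_fin_digraph.pair_finite_verts
    pair_graph_def pair_digraph_def by blast

lemma connected_Tw: "connected_pair_graph Tw"
proof -
  have fin: "finite (pverts Tw)"
  proof -
    have "pverts Tw = (\<Union>i\<in>I. q i ` pverts (T i))" unfolding pverts_Tw by blast
    then show ?thesis using finite_I finite_pverts_T by simp
  qed
  have arc: "\<exists>i x y. e = (q i x, q i y) \<and> i \<in> I \<and> (x, y) \<in> parcs (T i) \<and> (y, x) \<in> parcs (T i) \<and>
      x \<in> pverts (T i) \<and> y \<in> pverts (T i) \<and> x \<noteq> y" if e: "e \<in> parcs Tw" for e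
  proof -
    obtain i x y where ixy: "e = (q i x, q i y)" "i \<in> I" "(x, y) \<in> parcs (T i)"
      using e unfolding parcs_Tw by blast
    interpret connected_pair_graph "T i" using connected_T ixy by blast
    show ?thesis
      using ixy wellformed'[OF ixy(3)] pair_no_loops[OF ixy(3)] sym_parcs symD by fastforce
  qed
  have sub: "parcs Tw \<subseteq> pverts Tw \<times> pverts Tw"
    using arc unfolding pverts_Tw by fast
  show ?thesis
  proof
    show "finite (pverts Tw)" by (rule fin)
    show "finite (parcs Tw)" using fin sub by (meson finite_SigmaI finite_subset)
    show "fst e \<in> pverts Tw" "snd e \<in> pverts Tw" if "e \<in> parcs Tw" for e using sub that by auto
    \<comment> \<open>\<open>q i\<close> is injective on a branch, so no arc collapses to a
      loop.\<close>
    show "fst e \<noteq> snd e" if "e \<in> parcs Tw" for e using arc[OF that] q_eq_iff by auto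
    show "symmetric (with_proj Tw)"
      unfolding symmetric_def with_proj_simps
    proof (rule symI)
      fix a b assume "(a, b) \<in> parcs Tw"
      then show "(b, a) \<in> parcs Tw" using arc[of "(a, b)"] unfolding parcs_Tw by blast
    qed
    show "(u, v) \<in> (parcs Tw)\<^sup>*" if "u \<in> pverts Tw" "v \<in> pverts Tw" for u v
      using that relpow_D relpow_imp_rtrancl unfolding pverts_Tw by blast
  qed
qed

section \<open>Vertices, weights and the weight center of the union\<close>

lemma pverts_Tw_insert: "pverts Tw = insert hub (\<Union>i\<in>I. q i ` (pverts (T i) - {w i}))"
proof (intro antisym subsetI)
  fix v assume "v \<in> pverts Tw"
  then obtain i x where "i \<in> I" "x \<in> pverts (T i)" "v = q i x" unfolding pverts_Tw by auto
  then show "v \<in> insert hub (\<Union>i\<in>I. q i ` (pverts (T i) - {w i}))"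
    by (cases "x = w i") (auto simp: q_center)
next
  fix v assume "v \<in> insert hub (\<Union>i\<in>I. q i ` (pverts (T i) - {w i}))"
  then show "v \<in> pverts Tw" using hub_vertex by (auto simp: pverts_Tw)
qed

text \<open>Only centers are merged, so the branches without their centers embed disjointly. A
  constant \<open>h\<close> counts the vertices, and a distance as \<open>h\<close> gives
  weights.\<close>

lemma sum_pverts_Tw:
  "sum h (pverts Tw) = h hub + (\<Sum>i\<in>I. \<Sum>x\<in>pverts (T i) - {w i}. h (q i x))"
proof -
  define P where "P = (SIGMA i:I. pverts (T i) - {w i})"
  have fin: "finite P" unfolding P_def using finite_I finite_pverts_T by auto
  have inj: "inj_on (\<lambda>(i, x). q i x) P"
    unfolding P_def by (auto simp: inj_on_def q_eq_iff)
  have eq: "pverts Tw = insert hub ((\<lambda>(i, x). q i x) ` P)"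
    unfolding pverts_Tw_insert P_def by auto
  have "hub \<noteq> q i x" if "i \<in> I" "x \<noteq> w i" for i x
    using q_eq_iff[OF that(1) that(1), of x "w i"] q_center that by auto
  then have "hub \<notin> (\<lambda>(i, x). q i x) ` P" unfolding P_def by auto
  then have "sum h (pverts Tw) = h hub + sum h ((\<lambda>(i, x). q i x) ` P)"
    unfolding eq using fin by simp
  also have "sum h ((\<lambda>(i, x). q i x) ` P) = (\<Sum>(i, x)\<in>P. h (q i x))"
    by (subst sum.reindex[OF inj]) (simp add: case_prod_unfold)
  also have "\<dots> = (\<Sum>i\<in>I. \<Sum>x\<in>pverts (T i) - {w i}. h (q i x))"
    unfolding P_def using finite_I finite_pverts_T by (subst sum.Sigma) auto
  finally show ?thesis .
qed

lemma card_pverts_Tw: "card (pverts Tw) = 1 + (\<Sum>i\<in>I. card (pverts (T i)) - 1)"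
  using sum_pverts_Tw[of "\<lambda>_. 1 :: nat"] center_vertex finite_pverts_T
  by (simp add: card_Diff_singleton)

lemma sum_gdist_center:
  assumes "i \<in> I"
  shows "(\<Sum>x\<in>pverts (T i) - {w i}. gdist (T i) x (w i)) = weight_from (T i) (w i)"
  unfolding weight_from_def
  using connected_pair_graph.gdist_refl[OF connected_T center_vertex, OF assms assms]
    sum.remove[OF finite_pverts_T center_vertex, OF assms assms, of "\<lambda>x. gdist (T i) x (w i)"]
  by simp

lemma weight_from_hub: "weight_from Tw hub = (\<Sum>i\<in>I. weight_from (T i) (w i))"
proof -
  have "gdist Tw hub hub = 0"
    using connected_pair_graph.gdist_refl[OF connected_Tw hub_vertex] .
  then have "weight_from Tw hub = (\<Sum>i\<in>I. \<Sum>x\<in>pverts (T i) - {w i}. gdist Tw (q i x) hub)"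
    unfolding weight_from_def sum_pverts_Tw by simp
  also have "\<dots> = (\<Sum>i\<in>I. \<Sum>x\<in>pverts (T i) - {w i}. gdist (T i) x (w i))"
    using gdist_Tw_hub by simp
  also have "\<dots> = (\<Sum>i\<in>I. weight_from (T i) (w i))"
    using sum_gdist_center by simp
  finally show ?thesis .
qed

text \<open>Moving from \<open>hub\<close> to \<open>q i x\<close> raises the contribution of branch
  \<open>i\<close>, whose only weight center is \<open>w i\<close>. Distances to vertices of the
  other branches run through \<open>hub\<close> and therefore cannot drop.\<close>

lemma weight_from_hub_less:
  assumes i: "i \<in> I" "x \<in> pverts (T i)" "x \<noteq> w i"
  shows "weight_from Tw hub < weight_from Tw (q i x)"
proof -
  let ?s = "\<lambda>j. \<Sum>y\<in>pverts (T j) - {w j}. gdist Tw (q j y) (q i x)"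
  have "gdist Tw hub (q i x) = gdist (T i) (w i) x"
    using gdist_Tw_same[OF i(1) center_vertex[OF i(1)] i(2)] q_center[OF i(1)] by simp
  moreover have "?s i = (\<Sum>y\<in>pverts (T i) - {w i}. gdist (T i) y x)"
    using gdist_Tw_same i by simp
  \<comment> \<open>\<open>hub\<close> supplies the term of \<open>w i\<close>, which
    \<open>?s i\<close> omits.\<close>
  ultimately have "gdist Tw hub (q i x) + ?s i = weight_from (T i) x"
    unfolding weight_from_def
    using sum.remove[OF finite_pverts_T[OF i(1)] center_vertex[OF i(1)], of "\<lambda>y. gdist (T i) y x"]
    by simp
  moreover have "weight_from (T i) (w i) < weight_from (T i) x"
  proof -
    have "x \<notin> weight_centers (T i)" "w i \<in> weight_centers (T i)" using center_T i by auto
    then obtain y where y: "y \<in> pverts (T i)" "weight_from (T i) y < weight_from (T i) x"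
      using i unfolding weight_centers_def by (auto simp: not_le)
    moreover have "weight_from (T i) (w i) \<le> weight_from (T i) y"
      using \<open>w i \<in> weight_centers (T i)\<close> y(1) unfolding weight_centers_def by blast
    ultimately show ?thesis by simp
  qed
  moreover have "weight_from (T j) (w j) \<le> ?s j" if "j \<in> I - {i}" for j
  proof -
    have "(\<Sum>y\<in>pverts (T j) - {w j}. gdist (T j) y (w j)) \<le> ?s j"
      using that i by (intro sum_mono) (simp add: gdist_Tw D_def)
    then show ?thesis using sum_gdist_center that by simp
  qed
  then have "(\<Sum>j\<in>I - {i}. weight_from (T j) (w j)) \<le> (\<Sum>j\<in>I - {i}. ?s j)"
    by (rule sum_mono)
  moreover have "weight_from Tw (q i x) = gdist Tw hub (q i x) + ?s i + (\<Sum>j\<in>I - {i}. ?s j)"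
    unfolding weight_from_def sum_pverts_Tw using sum.remove[OF finite_I i(1), of ?s] by simp
  moreover have "weight_from Tw hub = weight_from (T i) (w i) + (\<Sum>j\<in>I - {i}. weight_from (T j) (w j))"
    unfolding weight_from_hub using sum.remove[OF finite_I i(1)] by blast
  ultimately show ?thesis by linarith
qed

lemma weight_centers_Tw: "weight_centers Tw = {hub}"
proof -
  have less: "weight_from Tw hub < weight_from Tw v" if "v \<in> pverts Tw" "v \<noteq> hub" for v
    using that weight_from_hub_less q_center unfolding pverts_Tw by blast
  then show ?thesis
    unfolding weight_centers_def using hub_vertex by (fastforce simp: not_le dest: less_imp_le)
qed

section \<open>Good ordering and total level of the union\<close>

lemma gdiam_T_le:
  assumes "i \<in> I"
  shows "gdiam (T i) \<le> gdiam Tw"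
proof -
  interpret i: connected_pair_graph "T i" using connected_T assms by blast
  interpret Tw: connected_pair_graph Tw by (rule connected_Tw)
  \<comment> \<open>Branches embed isometrically, so their distances occur in the union.\<close>
  have "gdist (T i) x y \<le> gdiam Tw" if "x \<in> pverts (T i)" "y \<in> pverts (T i)" for x y
    using Tw.gdist_le_gdiam[of "q i x" "q i y"] gdist_Tw_same assms that unfolding pverts_Tw
    by force
  then show ?thesis
    unfolding gdiam_def[of "T i"] using i.finite_gdists center_vertex[OF assms]
    by (subst Max_le_iff) auto
qed

lemma good_ordering_Tw:
  assumes diam: "\<And>i. i \<in> I \<Longrightarrow> 1 \<le> gdiam (T i)"
    and good: "\<And>i. i \<in> I \<Longrightarrow> good_ordering (T i) (u i)"
  shows "admits_good_ordering Tw"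
proof -
  interpret Tw: connected_pair_graph Tw by (rule connected_Tw)
  define c where "c = int (gdiam Tw) + 1"
  define l where "l v = int (gdist Tw v hub)" for v
  define d where "d v v' = int (gdist Tw v v')" for v v'
  let ?n = "\<lambda>i. card (pverts (T i))"
  \<comment> \<open>Branch \<open>i\<close> in its own order, without its center.\<close>
  define B where "B i = map (q i) (map (u i) [1..<?n i])" for i
  have u: "bij_betw (u i) {..<?n i} (pverts (T i))" "u i 0 = w i" "(u i (?n i - 1), w i) \<in> parcs (T i)"
    if "i \<in> I" for i
    using good[OF that] unfolding good_ordering_unique_center_iff[OF center_T[OF that]] by auto
  have n: "2 \<le> ?n i" if "i \<in> I" for i
    using connected_pair_graph.good_ordering_card_ge_2[OF connected_T center_T good] that by blast
  have set_us: "set (map (u i) [1..<?n i]) = pverts (T i) - {w i}" if "i \<in> I" for i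
  proof -
    have "{..<?n i} - {0} = {1..<?n i}" by auto
    then have "u i ` {1..<?n i} = u i ` {..<?n i} - u i ` {0}"
      using u(1)[OF that] n[OF that] inj_on_image_set_diff[of "u i" "{..<?n i}" "{..<?n i}" "{0}"]
      by (auto simp: bij_betw_def)
    then show ?thesis using u(1,2)[OF that] by (simp add: bij_betw_def)
  qed
  have set_B: "set (B i) = q i ` (pverts (T i) - {w i})" if "i \<in> I" for i
    using set_us[OF that] unfolding B_def set_map[of "q i"] by simp
  have bal_B: "balanced d l c (B i)" if "i \<in> I" for i
    unfolding B_def
  \<comment> \<open>\<open>q i\<close> preserves distances and levels, and \<open>gdiam_T_le\<close>
    allows every branch to use the common constant \<open>c\<close>.\<close>
  proof (rule balanced_map)
    show "balanced (\<lambda>x y. int (gdist (T i) x y)) (\<lambda>x. int (gdist (T i) x (w i))) c (map (u i) [1..<?n i])"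
      using connected_pair_graph.balanced_good_ordering[OF connected_T center_T good diam] that
        gdiam_T_le[OF that] unfolding c_def by simp
    show "d (q i x) (q i y) = int (gdist (T i) x y)"
      if "x \<in> set (map (u i) [1..<?n i])" "y \<in> set (map (u i) [1..<?n i])" for x y
      using that gdist_Tw_same \<open>i \<in> I\<close> unfolding set_us[OF \<open>i \<in> I\<close>] d_def by simp
    show "l (q i x) = int (gdist (T i) x (w i))" if "x \<in> set (map (u i) [1..<?n i])" for x
      using that gdist_Tw_hub \<open>i \<in> I\<close> unfolding set_us[OF \<open>i \<in> I\<close>] l_def by simp
  qed
  \<comment> \<open>The branches may follow each other in any order.\<close>
  obtain js where js: "set js = I" "distinct js"
    using finite_distinct_list[OF finite_I] by blast
  define xs where "xs = concat (map B js)"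
  define o_xs where "o_xs = hub # xs"
  have bal: "balanced d l c xs"
    unfolding xs_def
  proof (rule balanced_concat[OF js(2)])
    fix i j x y assume ij: "i \<in> set js" "j \<in> set js" "i \<noteq> j" "x \<in> set (B i)" "y \<in> set (B j)"
    then obtain a b where ab: "x = q i a" "a \<in> pverts (T i)" "y = q j b" "b \<in> pverts (T j)"
      using set_B js by auto
    have I: "i \<in> I" "j \<in> I" using ij js by auto
    have "gdist Tw x y = gdist (T i) a (w i) + gdist (T j) (w j) b"
      unfolding ab using gdist_Tw[OF I(1) ab(2) I(2) ab(4)] ij(3) by (simp add: D_def)
    also have "gdist (T j) (w j) b = gdist (T j) b (w j)"
      using connected_pair_graph.gdist_commute[OF connected_T center_vertex, OF I(2) I(2) ab(4)] .
    finally show "d x y = l x + l y"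
      unfolding d_def l_def ab gdist_Tw_hub[OF I(1) ab(2)] gdist_Tw_hub[OF I(2) ab(4)] by simp
  next
    show "balanced d l c (B j)" if "j \<in> set js" for j using bal_B that js(1) by simp
  qed
  have set_xs: "set o_xs = pverts Tw"
  proof -
    have "set xs = (\<Union>i\<in>I. q i ` (pverts (T i) - {w i}))"
      unfolding xs_def using js set_B by simp
    then show ?thesis unfolding o_xs_def pverts_Tw_insert by simp
  qed
  have len: "length o_xs = card (pverts Tw)"
  proof -
    have "length xs = (\<Sum>i\<leftarrow>js. ?n i - 1)"
      unfolding xs_def length_concat B_def by (simp add: comp_def)
    also have "\<dots> = (\<Sum>i\<in>I. ?n i - 1)" using js by (simp add: sum_list_distinct_conv_sum_set)
    finally show ?thesis unfolding o_xs_def card_pverts_Tw by simp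
  qed
  \<comment> \<open>The list covers all vertices and has just as many entries, so none
    repeats.\<close>
  have "distinct o_xs" using set_xs len by (intro card_distinct) simp
  then have bij: "bij_betw (nth o_xs) {..<card (pverts Tw)} (pverts Tw)"
    using set_xs len by (intro bij_betw_nth) auto
  have last: "(o_xs ! (card (pverts Tw) - 1), hub) \<in> parcs Tw"
  proof -
    \<comment> \<open>The ordering ends with the last vertex of the last branch \<open>j\<close>,
      which by (a) is adjacent to \<open>w j\<close> there.\<close>
    obtain js' j where js': "js = js' @ [j]" using js I_nonempty by (cases js rule: rev_cases) auto
    then have j: "j \<in> I" using js by auto
    have ne: "B j \<noteq> []" using n[OF j] unfolding B_def by simp
    have "o_xs ! (card (pverts Tw) - 1) = last o_xs"
      unfolding len[symmetric] o_xs_def by (simp add: last_conv_nth)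
    also have "\<dots> = last (B j)" unfolding o_xs_def xs_def js' using ne by simp
    also have "\<dots> = q j (u j (?n j - 1))"
      using n[OF j] unfolding B_def by (simp add: last_map)
    finally have "o_xs ! (card (pverts Tw) - 1) = q j (u j (?n j - 1))" .
    moreover have "(q j (u j (?n j - 1)), q j (w j)) \<in> parcs Tw"
      using u(3)[OF j] j unfolding parcs_Tw by blast
    ultimately show ?thesis using q_center[OF j] by simp
  qed
  have lhub: "l hub = 0" using Tw.gdist_refl hub_vertex by (simp add: l_def)
  have tight: "(\<Sum>t\<in>{i<..<j}. 2 * l (o_xs ! t) - c) \<le> d (o_xs ! i) (o_xs ! j) - l (o_xs ! i) - l (o_xs ! j)"
    if ij: "i < j" "j < card (pverts Tw)" for i j
  proof -
    obtain j' where j': "j = Suc j'" using ij by (cases j) auto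
    then have j'_less: "j' < length xs" using ij len by (simp add: o_xs_def)
    \<comment> \<open>The leading \<open>hub\<close> moves all positions of \<open>xs\<close> by
      one.\<close>
    have shift: "(\<Sum>t\<in>{i<..<j}. 2 * l (o_xs ! t) - c) = (\<Sum>t = i..<j'. 2 * l (xs ! t) - c)"
      unfolding atLeastSucLessThan_greaterThanLessThan[symmetric] j' sum.shift_bounds_Suc_ivl
      by (simp add: o_xs_def)
    show ?thesis
    proof (cases i)
      \<comment> \<open>Against \<open>hub\<close> the right-hand side is 0, and the prefix clause
        of \<open>balanced\<close> suffices.\<close>
      case 0
      have "xs ! j' \<in> pverts Tw" using j'_less set_xs unfolding o_xs_def by auto
      then have "d hub (xs ! j') = l (xs ! j')"
        using Tw.gdist_commute hub_vertex by (simp add: d_def l_def)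
      moreover have "(\<Sum>t = 0..<j'. 2 * l (xs ! t) - c) \<le> 0"
        using bal j'_less unfolding balanced_def by simp
      ultimately show ?thesis unfolding shift unfolding 0 j' o_xs_def by (simp add: lhub)
    next
      case (Suc i')
      then have "i' < j'" using ij j' by simp
      then have "(\<Sum>t = Suc i'..<j'. 2 * l (xs ! t) - c) \<le> d (xs ! i') (xs ! j') - l (xs ! i') - l (xs ! j')"
        using bal j'_less unfolding balanced_def by blast
      then show ?thesis unfolding shift unfolding Suc j' o_xs_def by simp
    qed
  qed
  have hd: "o_xs ! 0 = hub" by (simp add: o_xs_def)
  have "good_ordering Tw (nth o_xs)"
    unfolding good_ordering_unique_center_iff[OF weight_centers_Tw]
    using bij last hd tight unfolding d_def l_def c_def by (intro conjI allI impI) auto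
  then show ?thesis unfolding admits_good_ordering_def by (rule exI[where x = "nth o_xs"])
qed

lemma sum_gdist_hub:
  "(\<Sum>v\<in>pverts Tw. int (gdist Tw v hub)) = (\<Sum>i\<in>I. \<Sum>x\<in>pverts (T i). int (gdist (T i) x (w i)))"
proof -
  have "int (weight_from Tw hub) = (\<Sum>i\<in>I. int (weight_from (T i) (w i)))"
    unfolding weight_from_hub by (rule of_nat_sum)
  then show ?thesis unfolding weight_from_def of_nat_sum .
qed

end

theorem theorem3p1:
  fixes k :: nat
    and T :: "nat \<Rightarrow> 'a pair_pre_digraph"
    and w :: "nat \<Rightarrow> 'a"
  assumes "k \<ge> 1"
    and "\<And>i. i \<in> {1..k} \<Longrightarrow> undirected_tree (T i)"
    and "\<And>i. i \<in> {1..k} \<Longrightarrow> gdiam (T i) \<ge> 2"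
    and "\<And>i. i \<in> {1..k} \<Longrightarrow> weight_centers (T i) = {w i}"
    and "\<And>i. i \<in> {1..k} \<Longrightarrow> admits_good_ordering (T i)"
  shows "let Tw = one_point_union {1..k} T w; d = gdiam Tw in
           admits_good_ordering Tw \<and>
           int (radio_number Tw) =
             (\<Sum>i = 1..k. int (radio_number (T i)) +
                (int (card (pverts (T i))) - 1) * (int d - int (gdiam (T i))))
             - int k + 1"
proof -
  interpret F: centered_graph_family "{1..k}" T w
    using assms(1,2,4) undirected_tree_connected by (intro centered_graph_family.intro) auto
  define W where "W = one_point_union {1..k} T w"
  define d where "d = gdiam W"
  let ?n = "\<lambda>i. int (card (pverts (T i)))" and ?L = "\<lambda>i. \<Sum>x\<in>pverts (T i). int (gdist (T i) x (w i))"
  obtain u where u: "\<And>i. i \<in> {1..k} \<Longrightarrow> good_ordering (T i) (u i)"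
    using assms(5) unfolding admits_good_ordering_def by metis
  have "1 \<le> gdiam (T i)" if "i \<in> {1..k}" for i using assms(3)[OF that] by simp
  then have good: "admits_good_ordering W" unfolding W_def using u by (rule F.good_ordering_Tw)
  have "int (radio_number W) =
      (int (card (pverts W)) - 1) * (int d + 1) - 2 * (\<Sum>v\<in>pverts W. int (gdist W v F.hub)) + 1"
    using good connected_pair_graph.radio_number_good_ordering[OF F.connected_Tw F.weight_centers_Tw]
    unfolding admits_good_ordering_def W_def d_def by blast
  also have "(\<Sum>v\<in>pverts W. int (gdist W v F.hub)) = (\<Sum>i = 1..k. ?L i)"
    unfolding W_def by (rule F.sum_gdist_hub)
  also have "int (card (pverts W)) - 1 = (\<Sum>i = 1..k. ?n i - 1)"
  proof -
    \<comment> \<open>\<open>card_pverts_Tw\<close> subtracts in \<open>nat\<close>; each branch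
      contains its center, so nothing is truncated.\<close>
    have "1 \<le> card (pverts (T i))" if "i \<in> {1..k}" for i
      using F.center_vertex F.finite_pverts_T that by (metis One_nat_def Suc_leI card_gt_0_iff empty_iff)
    then show ?thesis unfolding W_def F.card_pverts_Tw by (simp add: of_nat_diff)
  qed
  \<comment> \<open>Splitting \<open>d + 1\<close> as
    \<open>(gdiam (T i) + 1) + (d - gdiam (T i))\<close> exposes the radio number of each branch;
    the \<open>+ 1\<close> of that formula then occurs \<open>k\<close> times, whence the
    \<open>- int k\<close>.\<close>
  also have "(\<Sum>i = 1..k. ?n i - 1) * (int d + 1) - 2 * (\<Sum>i = 1..k. ?L i) + 1 =
      (\<Sum>i = 1..k. (?n i - 1) * (int (gdiam (T i)) + 1) - 2 * ?L i + 1
                     + (?n i - 1) * (int d - int (gdiam (T i)))) - int k + 1"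
  proof -
    have "(\<Sum>i = 1..k. (?n i - 1) * (int (gdiam (T i)) + 1) - 2 * ?L i + 1
                     + (?n i - 1) * (int d - int (gdiam (T i)))) =
          (\<Sum>i = 1..k. (?n i - 1) * (int d + 1) - 2 * ?L i + 1)"
      by (intro sum.cong) (auto simp: algebra_simps)
    also have "\<dots> = (\<Sum>i = 1..k. ?n i - 1) * (int d + 1) - 2 * (\<Sum>i = 1..k. ?L i) + int k"
      by (simp add: sum.distrib sum_subtractf flip: sum_distrib_left sum_distrib_right)
    finally show ?thesis by simp
  qed
  also have "\<dots> = (\<Sum>i = 1..k. int (radio_number (T i))
                     + (?n i - 1) * (int d - int (gdiam (T i)))) - int k + 1"
    using connected_pair_graph.radio_number_good_ordering[OF F.connected_T assms(4) u] by simp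
  finally show ?thesis using good unfolding W_def d_def Let_def by blast
qed

end
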